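(* Let $D\subset\mathbb{Z}$ be an arbitrary set of traps. The model with trap set $D$ is critical if and only if $\mathbb{E}_x(T)=\infty$ for every $x\in\mathbb{Z}$, and this is in turn equivalent to the existence of some $x\in\mathbb{Z}$ such that $\mathbb{E}_x(T)=\infty$.
   Context: Trapped random walk. Let $s$ be an extra absorbing state (the sink). The walk $(X_n)_{n\ge 0}$ is the Markov chain on $\mathbb{Z}\cup\{s\}$ such that: from $x\in\mathbb{Z}\setminus D$ it moves to $x-1$ or $x+1$ with probability $1/2$ each; from $x\in D$ it moves to $x-1$, $x+1$ or $s$ with probability $1/3$ each; $s$ is absorbing. $T=\inf\{n\ge 1: X_n=s\}\in[0,\infty]$ and $\mathbb{E}_x$ denotes expectation for the walk started at $X_0=x$. Criticality. Define $\deg(x)=2+\mathbf 1_{x\in D}$ for $x\in\mathbb{Z}$ and the Laplacian matrix $\Delta$ by $\Delta_{x,x}=\deg(x)$, $\Delta_{x,y}=-1$ if $|x-y|=1$, and $\Delta_{x,y}=0$ otherwise. For $n\in\mathbb{N}$ let $\Delta_n$ be the restriction of the matrix $\Delta$ to rows and columns indexed by $\{-n,\dots,n\}$, and let $G_n(x,y)=(\Delta_n^{-1})(x,y)$ (extended by $0$ when $x$ or $y$ is outside $\{-n,\dots,n\}$). $G_n(x,y)$ is nondecreasing in $n$; put $G(x,y)=\lim_{n\to\infty}G_n(x,y)\in[0,\infty]$. The model is called non-critical if for all $x\in\mathbb{Z}$, $\sum_{y\in\mathbb{Z}}G(x,y)=\lim_{n\to\infty}\sum_{y\in\mathbb{Z}}G_n(x,y)<\infty$;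 otherwise it is called critical. *)

theory Defs
  imports
    "HOL-Probability.Probability"
    "Jordan_Normal_Form.Gauss_Jordan_Elimination"
begin

section \<open>The trapped random walk\<close>

text \<open>The state space is \<^typ>\<open>int option\<close>; \<^term>\<open>None\<close> is the absorbing sink \<open>s\<close>.\<close>

definition walk_step :: "int set \<Rightarrow> int option \<Rightarrow> int option pmf" where
  "walk_step D z = (case z of
      None \<Rightarrow> return_pmf None
    | Some x \<Rightarrow>
        if x \<in> D then pmf_of_set {Some (x - 1), Some (x + 1), None}
        else pmf_of_set {Some (x - 1), Some (x + 1)})"

text \<open>
  The law of \<open>X\<^sub>n\<close> given the path \<open>(X\<^sub>0, \<dots>, X\<^bsub>n-1\<^esub>)\<close>, for the walk started at \<open>x\<close>, and the
  law on path space \<open>nat \<Rightarrow> int option\<close> which the Ionescu-Tulcea theorem builds from it.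
  Lemma \<open>emeasure_walk_cylinder\<close> below confirms that under \<open>walk D x\<close> the coordinate process is
  the Markov chain with transition probabilities \<open>walk_step D\<close> started at \<open>x\<close>.
\<close>

definition walk_kernel :: "int set \<Rightarrow> int \<Rightarrow> nat \<Rightarrow> (nat \<Rightarrow> int option) \<Rightarrow> int option measure" where
  "walk_kernel D x n \<omega> =
     measure_pmf (case n of 0 \<Rightarrow> return_pmf (Some x) | Suc m \<Rightarrow> walk_step D (\<omega> m))"

definition walk :: "int set \<Rightarrow> int \<Rightarrow> (nat \<Rightarrow> int option) measure" where
  "walk D x =
     projective_family.lim UNIV
       (Ionescu_Tulcea.CI (walk_kernel D x) (\<lambda>_. count_space UNIV)) (\<lambda>_. count_space UNIV)"

definition sink_time :: "(nat \<Rightarrow> int option) \<Rightarrow> ennreal" where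
  "sink_time \<omega> = (INF n \<in> {n. 1 \<le> n \<and> \<omega> n = None}. of_nat n)"

definition expected_sink_time :: "int set \<Rightarrow> int \<Rightarrow> ennreal" where
  "expected_sink_time D x = (\<integral>\<^sup>+ \<omega>. sink_time \<omega> \<partial>walk D x)"


section \<open>Criticality\<close>

definition trap_deg :: "int set \<Rightarrow> int \<Rightarrow> real" where
  "trap_deg D x = 2 + indicator D x"

definition laplacian :: "int set \<Rightarrow> int \<Rightarrow> int \<Rightarrow> real" where
  "laplacian D x y = (if x = y then trap_deg D x else if \<bar>x - y\<bar> = 1 then -1 else 0)"

text \<open>
  Index \<open>i < 2 * n + 1\<close> of a matrix stands for the site \<open>i - n\<close> of \<open>{-n..n}\<close>.
  The matrix is irreducibly diagonally dominant, hence invertible with a nonnegative inverse that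
  is nondecreasing in \<open>n\<close>: \<^const>\<open>the\<close>, \<^const>\<open>ennreal\<close> and \<^const>\<open>lim\<close> below are applied in their
  proper ranges.
\<close>

definition box_laplacian :: "int set \<Rightarrow> nat \<Rightarrow> real Matrix.mat" where
  "box_laplacian D n =
     Matrix.mat (2 * n + 1) (2 * n + 1) (\<lambda>(i, j). laplacian D (int i - int n) (int j - int n))"

definition box_green :: "int set \<Rightarrow> nat \<Rightarrow> int \<Rightarrow> int \<Rightarrow> real" where
  "box_green D n x y =
     (if x \<in> {- int n..int n} \<and> y \<in> {- int n..int n}
      then the (mat_inverse (box_laplacian D n)) $$ (nat (x + int n), nat (y + int n))
      else 0)"

definition green :: "int set \<Rightarrow> int \<Rightarrow> int \<Rightarrow> ennreal" where
  "green D x y = lim (\<lambda>n. ennreal (box_green D n x y))"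

definition noncritical :: "int set \<Rightarrow> bool" where
  "noncritical D \<longleftrightarrow> (\<forall>x. (\<Sum>\<^sub>\<infinity> y\<in>UNIV. green D x y) < \<infinity>)"

definition critical :: "int set \<Rightarrow> bool" where
  "critical D \<longleftrightarrow> \<not> noncritical D"


section \<open>The path measure is the law of the trapped walk\<close>

lemma Ionescu_Tulcea_walk_kernel:
  "Ionescu_Tulcea (walk_kernel D x) (\<lambda>_. count_space UNIV)"
proof (rule Ionescu_Tulcea.intro)
  fix i
  show "walk_kernel D x i \<in> measurable (PiM {0..<i} (\<lambda>_. count_space UNIV)) (subprob_algebra (count_space UNIV))"
  proof (cases i)
    case 0
    then show ?thesis
      by (simp add: walk_kernel_def[abs_def] measure_pmf_in_subprob_algebra)
  next
    case (Suc m)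
    have 1: "(\<lambda>\<omega>. \<omega> m) \<in> measurable (PiM {0..<Suc m} (\<lambda>_. count_space (UNIV :: int option set))) (count_space UNIV)"
      by (rule measurable_component_singleton) simp
    have 2: "(\<lambda>z. measure_pmf (walk_step D z)) \<in> measurable (count_space UNIV) (subprob_algebra (count_space UNIV))"
      by (simp add: measure_pmf_in_subprob_algebra)
    show ?thesis
      using measurable_compose[OF 1 2] by (simp add: walk_kernel_def[abs_def] Suc)
  qed
qed (simp add: walk_kernel_def measure_pmf.prob_space_axioms)

context
  fixes D :: "int set" and x :: int
begin

interpretation IT: Ionescu_Tulcea "walk_kernel D x" "\<lambda>_. count_space UNIV"
  by (rule Ionescu_Tulcea_walk_kernel)

lemma sets_walk [measurable_cong]:
  "sets (walk D x) = sets (PiM UNIV (\<lambda>_. count_space UNIV))"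
  by (simp add: walk_def)

lemma space_walk [simp]: "space (walk D x) = UNIV"
  using sets_eq_imp_space_eq[OF sets_walk] by (simp add: space_PiM)

lemma prob_space_walk: "prob_space (walk D x)"
proof
  let ?M = "\<lambda>_::nat. count_space (UNIV :: int option set)"
  have "emeasure (walk D x) (prod_emb UNIV ?M {} (space (PiM {} ?M))) = emeasure (IT.CI {}) (space (PiM {} ?M))"
    unfolding walk_def by (rule IT.lim) auto
  also have "\<dots> = 1"
    using prob_space.emeasure_space_1[OF IT.PF.prob_space_P[of "{}"]] by (simp add: IT.PF.space_P)
  finally show "emeasure (walk D x) (space (walk D x)) = 1"
    by (simp add: prod_emb_def space_PiM PiE_def restrict_def vimage_def)
qed

lemma singleton_in_sets_PiM:
  "{restrict w {0..<n}} \<in> sets (PiM {0..<n::nat} (\<lambda>_. count_space (UNIV :: int option set)))"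
proof -
  have "{restrict w {0..<n}} = (PiE {0..<n} (\<lambda>i. {w i}))"
    by (auto simp: PiE_iff extensional_def fun_eq_iff)
  also have "\<dots> \<in> sets (PiM {0..<n} (\<lambda>_. count_space UNIV))"
    by (rule sets_PiM_I_finite) auto
  finally show ?thesis .
qed

lemma emeasure_C_cylinder:
  "emeasure (IT.C 0 n (\<lambda>_. undefined)) {restrict w {0..<n}} =
     (\<Prod>i<n. emeasure (walk_kernel D x i w) {w i})"
proof (induction n)
  case 0
  have "(\<lambda>i::nat. undefined :: int option) = restrict w {0..<0}"
    by auto
  then show ?case
    using singleton_in_sets_PiM[of w 0] by simp
next
  case (Suc n)
  let ?M = "\<lambda>_::nat. count_space (UNIV :: int option set)"
  let ?C = "IT.C 0 n (\<lambda>_. undefined)"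
  let ?r = "restrict w {0..<n}" and ?s = "restrict w {0..<Suc n}"
  have u: "(\<lambda>_. undefined) \<in> space (PiM {0..<0} ?M)"
    by (simp add: space_PiM)
  have sp: "space ?C = space (PiM {0..<n} ?M)"
    using IT.space_C[OF u, of n] by simp
  have se: "sets ?C = sets (PiM {0..<n} ?M)"
    using IT.sets_C[OF u, of n] by simp
  have m: "IT.eP n \<in> measurable ?C (subprob_algebra (PiM {0..<Suc n} ?M))"
    using IT.measurable_eP[of n] by (simp add: measurable_cong_sets[OF se refl])
  have ne: "space ?C \<noteq> {}"
    by (simp add: sp space_PiM PiE_eq_empty_iff)
  have eq: "emeasure (IT.eP n \<omega>) {?s} = emeasure (walk_kernel D x n w) {w n} * indicator {?r} \<omega>"
    if \<omega>: "\<omega> \<in> space ?C" for \<omega>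
  proof -
    have \<omega>': "\<omega> \<in> space (PiM {0..<n} ?M)"
      using \<omega> sp by simp
    have ext: "\<omega> i = undefined" if "\<not> i < n" for i
      using \<omega>' that by (auto simp: space_PiM PiE_iff extensional_def)
    have 1: "emeasure (IT.eP n \<omega>) {?s} = emeasure (walk_kernel D x n \<omega>) ((\<lambda>y. fun_upd \<omega> n y) -` {?s})"
      using IT.emeasure_eP[OF \<omega>' singleton_in_sets_PiM[of w "Suc n"]] by simp
    have 2: "fun_upd \<omega> n y = ?s \<longleftrightarrow> \<omega> = ?r \<and> y = w n" for y
    proof
      assume eq: "fun_upd \<omega> n y = ?s"
      have "\<omega> i = ?r i" for i
        using fun_cong[OF eq, of i] ext[of i] by (cases "i < n") auto
      moreover have "y = w n"
        using fun_cong[OF eq, of n] by simp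
      ultimately show "\<omega> = ?r \<and> y = w n"
        by auto
    next
      assume "\<omega> = ?r \<and> y = w n"
      then show "fun_upd \<omega> n y = ?s"
        by (auto simp: fun_eq_iff less_Suc_eq)
    qed
    show ?thesis
    proof (cases "\<omega> = ?r")
      case True
      have "(\<lambda>y. fun_upd \<omega> n y) -` {?s} = {w n}"
        using 2 True by auto
      moreover have "walk_kernel D x n \<omega> = walk_kernel D x n w"
        using True by (simp add: walk_kernel_def split: nat.split)
      ultimately show ?thesis
        using 1 True by simp
    next
      case False
      then have "(\<lambda>y. fun_upd \<omega> n y) -` {?s} = {}"
        using 2 by auto
      then show ?thesis
        using 1 False by simp
    qed
  qed
  have "emeasure (IT.C 0 (Suc n) (\<lambda>_. undefined)) {?s} = (\<integral>\<^sup>+ \<omega>. emeasure (IT.eP n \<omega>) {?s} \<partial>?C)"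
    using emeasure_bind[OF ne m singleton_in_sets_PiM[of w "Suc n"]] by simp
  also have "\<dots> = (\<integral>\<^sup>+ \<omega>. emeasure (walk_kernel D x n w) {w n} * indicator {?r} \<omega> \<partial>?C)"
    by (rule nn_integral_cong) (rule eq)
  also have "\<dots> = emeasure (walk_kernel D x n w) {w n} * emeasure ?C {?r}"
    using singleton_in_sets_PiM[of w n] se by (intro nn_integral_cmult_indicator) simp
  finally show ?case
    unfolding Suc.IH by (simp only: prod.lessThan_Suc mult.commute)
qed

lemma emeasure_walk_cylinder:
  "emeasure (walk D x) {\<omega>. \<forall>i\<le>n. \<omega> i = w i} =
     ennreal (indicator {Some x} (w 0) * (\<Prod>i<n. pmf (walk_step D (w i)) (w (Suc i))))"
proof -
  let ?M = "\<lambda>_::nat. count_space (UNIV :: int option set)"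
  let ?J = "{0..<Suc n}"
  let ?s = "restrict w ?J"
  have "{\<omega>. \<forall>i\<le>n. \<omega> i = w i} = prod_emb UNIV ?M ?J {?s}"
    by (auto simp: prod_emb_def space_PiM fun_eq_iff less_Suc_eq_le restrict_def) metis
  then have "emeasure (walk D x) {\<omega>. \<forall>i\<le>n. \<omega> i = w i} = emeasure (IT.CI ?J) {?s}"
    unfolding walk_def using IT.lim[OF _ singleton_in_sets_PiM[of w "Suc n"]] by simp
  also have "\<dots> = emeasure (IT.C 0 (Suc n) (\<lambda>_. undefined)) (prod_emb ?J ?M ?J {?s})"
    by (rule IT.emeasure_CI[OF order_refl singleton_in_sets_PiM])
  also have "prod_emb ?J ?M ?J {?s} = {?s}"
    by (rule prod_emb_id) (auto simp: PiE_iff)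
  also have "emeasure (IT.C 0 (Suc n) (\<lambda>_. undefined)) {?s} = (\<Prod>i<Suc n. emeasure (walk_kernel D x i w) {w i})"
    by (rule emeasure_C_cylinder)
  also have "\<dots> = emeasure (walk_kernel D x 0 w) {w 0} * (\<Prod>i<n. emeasure (walk_kernel D x (Suc i) w) {w (Suc i)})"
    by (rule prod.lessThan_Suc_shift)
  also have "emeasure (walk_kernel D x 0 w) {w 0} = ennreal (indicator {Some x} (w 0))"
    by (simp add: walk_kernel_def emeasure_pmf_single indicator_def)
  also have "(\<Prod>i<n. emeasure (walk_kernel D x (Suc i) w) {w (Suc i)})
      = ennreal (\<Prod>i<n. pmf (walk_step D (w i)) (w (Suc i)))"
    by (simp add: walk_kernel_def emeasure_pmf_single prod_ennreal)
  finally show ?thesis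
    by (simp add: ennreal_mult prod_nonneg)
qed

end

lemma borel_measurable_sink_time [measurable]:
  "sink_time \<in> borel_measurable (PiM UNIV (\<lambda>_. count_space UNIV))"
proof -
  have eq: "sink_time = (\<lambda>\<omega>. INF n. if 1 \<le> n \<and> \<omega> n = None then of_nat n else (\<infinity>::ennreal))"
  proof
    fix \<omega> :: "nat \<Rightarrow> int option"
    show "sink_time \<omega> = (INF n. if 1 \<le> n \<and> \<omega> n = None then of_nat n else (\<infinity>::ennreal))"
      unfolding sink_time_def
    proof (rule antisym; intro INF_greatest)
      fix n
      show "(INF n\<in>{n. 1 \<le> n \<and> \<omega> n = None}. of_nat n) \<le> (if 1 \<le> n \<and> \<omega> n = None then of_nat n else (\<infinity>::ennreal))"
        by (auto intro: INF_lower)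
    next
      fix n
      assume "n \<in> {n. 1 \<le> n \<and> \<omega> n = None}"
      then show "(INF n. if 1 \<le> n \<and> \<omega> n = None then of_nat n else (\<infinity>::ennreal)) \<le> of_nat n"
        by (intro INF_lower2[of n]) auto
    qed
  qed
  have [measurable]: "(\<lambda>\<omega>. \<omega> n) \<in> measurable (PiM UNIV (\<lambda>_. count_space (UNIV :: int option set))) (count_space UNIV)" for n :: nat
    by (rule measurable_component_singleton) simp
  show ?thesis
    unfolding eq by measurable
qed

end

theory Submission
  imports Defs "Jordan_Normal_Form.Determinant"
begin

text \<open>
  Both sides are governed by the equation \<open>\<Delta> f = const\<close>. The row sums \<open>S\<^sub>n\<close> of \<open>G\<^sub>n\<close> solve
  \<open>\<Delta> S\<^sub>n = 1\<close> in the box \<open>{-n..n}\<close> and vanish outside. A first-step analysis shows that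
  \<open>e x = E\<^sub>x(T)\<close> satisfies \<open>deg x * e x = deg x + e (x - 1) + e (x + 1)\<close>; in particular \<open>e\<close> is
  finite everywhere or nowhere. If it is finite, then \<open>\<Delta> e = deg \<ge> 1\<close>, so \<open>S\<^sub>n \<le> e\<close> by
  the minimum principle. Conversely, the truncated expectations \<open>\<Sum>k<m. P\<^sub>x(T > k)\<close> are bounded by
  \<open>3 * S\<^sub>n x\<close> for large \<open>n\<close>, because \<open>3 * S\<^sub>n\<close> is a supersolution (\<open>deg \<le> 3\<close>) of their recursion.
\<close>

section \<open>The minimum principle\<close>

text \<open>The matrix \<Delta> acting on functions on the integers: row \<open>x\<close> has three
  nonzero entries, so no infinite sum is needed.\<close>

definition trap_laplace :: "int set \<Rightarrow> (int \<Rightarrow> real) \<Rightarrow> int \<Rightarrow> real" where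
  "trap_laplace D f x = trap_deg D x * f x - f (x - 1) - f (x + 1)"

lemma trap_deg_ge: "2 \<le> trap_deg D x"
  by (simp add: trap_deg_def)

lemma trap_deg_le: "trap_deg D x \<le> 3"
  by (simp add: trap_deg_def indicator_def)

lemma trap_laplace_diff:
  "trap_laplace D (\<lambda>x. f x - g x) x = trap_laplace D f x - trap_laplace D g x"
  by (simp add: trap_laplace_def algebra_simps)

lemma trap_laplace_uminus:
  "trap_laplace D (\<lambda>x. - f x) x = - trap_laplace D f x"
  by (simp add: trap_laplace_def)

lemma trap_laplace_sum:
  "trap_laplace D (\<lambda>x. \<Sum>y\<in>A. f x y) x = (\<Sum>y\<in>A. trap_laplace D (\<lambda>x. f x y) x)"
  by (simp add: trap_laplace_def sum_distrib_left sum_subtractf)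

text \<open>A negative minimum would be attained inside the box. At its leftmost minimiser the left
  neighbour is strictly larger and the degree is at least 2, which makes the Laplacian negative
  there.\<close>

lemma trap_laplace_minimum_principle:
  fixes a b :: int
  assumes super: "\<And>x. a \<le> x \<Longrightarrow> x \<le> b \<Longrightarrow> 0 \<le> trap_laplace D f x"
    and left: "0 \<le> f (a - 1)" and right: "0 \<le> f (b + 1)"
    and x: "a \<le> x" "x \<le> b"
  shows "0 \<le> f x"
proof (rule ccontr)
  assume neg: "\<not> 0 \<le> f x"
  let ?I = "{a - 1..b + 1}"
  define m where "m = Min (f ` ?I)"
  have fin: "finite (f ` ?I)" "f ` ?I \<noteq> {}"
    using x by auto
  have m_le: "m \<le> f y" if "y \<in> ?I" for y
    unfolding m_def using fin that by (intro Min_le) auto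
  have "m < 0"
    using m_le[of x] x neg by simp
  \<comment> \<open>Choosing the leftmost minimiser makes the inequality strict at
    \<open>z - 1\<close>. The strictness is what yields a contradiction at sites of degree exactly
    2.\<close>
  define z where "z = Min {y \<in> ?I. f y = m}"
  have "m \<in> f ` ?I"
    unfolding m_def using fin by (rule Min_in)
  then have ne: "{y \<in> ?I. f y = m} \<noteq> {}"
    by auto
  have fin_z: "finite {y \<in> ?I. f y = m}"
    by (rule finite_subset[of _ ?I]) auto
  have "z \<in> {y \<in> ?I. f y = m}"
    unfolding z_def using fin_z ne by (rule Min_in)
  then have z: "z \<in> ?I" "f z = m"
    by auto
  have "z \<noteq> a - 1" "z \<noteq> b + 1"
    using left right z(2) \<open>m < 0\<close> by auto
  then have z_in: "a \<le> z" "z \<le> b"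
    using z(1) by auto
  have "f (z - 1) \<noteq> m"
  proof
    assume "f (z - 1) = m"
    then have "z \<le> z - 1"
      using z_in fin_z by (subst (1) z_def, intro Min_le) auto
    then show False by simp
  qed
  with m_le[of "z - 1"] z_in have "m < f (z - 1)"
    by auto
  moreover have "m \<le> f (z + 1)"
    using m_le z_in by auto
  \<comment> \<open>As \<open>m < 0\<close>, a larger degree only lowers the diagonal term, so the
    Laplacian at \<open>z\<close> is below \<open>2 * m - m - m = 0\<close>.\<close>
  moreover have "trap_deg D z * m \<le> 2 * m"
    using trap_deg_ge[of D z] \<open>m < 0\<close> by (simp add: mult_right_mono_neg)
  ultimately show False
    using super[OF z_in] z(2) by (simp add: trap_laplace_def)
qed

section \<open>The Green function of a box\<close>

lemma sum_laplacian:
  assumes x: "x \<in> {- int n..int n}" and f: "\<And>y. y \<notin> {- int n..int n} \<Longrightarrow> f y = 0"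
  shows "(\<Sum>y\<in>{- int n..int n}. laplacian D x y * f y) = trap_laplace D f x"
proof -
  \<comment> \<open>One extra site on each side makes room for the neighbours of the end points;
    \<open>f\<close> vanishes there, so the sum is unchanged.\<close>
  have "(\<Sum>y\<in>{- int n..int n}. laplacian D x y * f y)
      = (\<Sum>y\<in>{- int n - 1..int n + 1}. laplacian D x y * f y)"
    by (intro sum.mono_neutral_left) (auto simp: f)
  also have "\<dots> = (\<Sum>y\<in>{x, x - 1, x + 1}. laplacian D x y * f y)"
    using x by (intro sum.mono_neutral_right) (auto simp: laplacian_def)
  finally show ?thesis
    by (simp add: laplacian_def trap_laplace_def)
qed

lemma sum_box_index:
  "(\<Sum>j<2 * n + 1. g (int j - int n)) = (\<Sum>y\<in>{- int n..int n}. g y)"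
  by (rule sum.reindex_bij_witness[where i = "\<lambda>y. nat (y + int n)" and j = "\<lambda>j. int j - int n"]) auto

lemma box_laplacian_carrier: "box_laplacian D n \<in> carrier_mat (2 * n + 1) (2 * n + 1)"
  by (simp add: box_laplacian_def)

text \<open>Translates matrix products into \<open>trap_laplace\<close> of the vector extended by 0
  outside the box. It serves both for kernel vectors and for columns of the inverse.\<close>

lemma box_laplacian_row_sum:
  assumes x: "x \<in> {- int n..int n}"
  shows "(\<Sum>j<2 * n + 1. box_laplacian D n $$ (nat (x + int n), j) * v j) =
    trap_laplace D (\<lambda>y. if y \<in> {- int n..int n} then v (nat (y + int n)) else 0) x"
    (is "_ = trap_laplace D ?f x")
proof -
  have "(\<Sum>j<2 * n + 1. box_laplacian D n $$ (nat (x + int n), j) * v j)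
      = (\<Sum>j<2 * n + 1. laplacian D x (int j - int n) * ?f (int j - int n))"
    using x by (intro sum.cong) (auto simp: box_laplacian_def)
  also have "\<dots> = (\<Sum>y\<in>{- int n..int n}. laplacian D x y * ?f y)"
    by (rule sum_box_index)
  also have "\<dots> = trap_laplace D ?f x"
    using x by (rule sum_laplacian) auto
  finally show ?thesis .
qed

text \<open>A kernel vector, extended by 0, is harmonic in the box with zero boundary values. The
  minimum principle for it and for its negative forces it to vanish.\<close>

lemma det_box_laplacian: "Determinant.det (box_laplacian D n) \<noteq> 0"
proof
  assume "Determinant.det (box_laplacian D n) = 0"
  then obtain v where v: "v \<in> carrier_vec (2 * n + 1)" "v \<noteq> 0\<^sub>v (2 * n + 1)"
    "box_laplacian D n *\<^sub>v v = 0\<^sub>v (2 * n + 1)"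
    using det_0_iff_vec_prod_zero_field[OF box_laplacian_carrier] by blast
  define f where "f = (\<lambda>y. if y \<in> {- int n..int n} then v $ nat (y + int n) else 0)"
  have harm: "trap_laplace D f x = 0" if x: "- int n \<le> x" "x \<le> int n" for x
  proof -
    have i: "nat (x + int n) < 2 * n + 1"
      using x by auto
    have "trap_laplace D f x = (\<Sum>j<2 * n + 1. box_laplacian D n $$ (nat (x + int n), j) * v $ j)"
      unfolding f_def using x by (intro box_laplacian_row_sum[symmetric]) auto
    also have "\<dots> = (box_laplacian D n *\<^sub>v v) $ nat (x + int n)"
      using i v(1) box_laplacian_carrier[of D n]
      by (simp add: scalar_prod_def atLeast0LessThan)
    also have "\<dots> = 0"
      using i v(3) by simp
    finally show ?thesis .
  qed
  have bdry: "f (- int n - 1) = 0" "f (int n + 1) = 0"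
    by (simp_all add: f_def)
  have f0: "f x = 0" if x: "- int n \<le> x" "x \<le> int n" for x
  proof (rule antisym)
    show "0 \<le> f x"
      by (rule trap_laplace_minimum_principle[of "- int n" "int n" D f x])
        (simp_all add: harm bdry x)
    have "0 \<le> - f x"
      by (rule trap_laplace_minimum_principle[of "- int n" "int n" D "\<lambda>y. - f y" x])
        (simp_all add: trap_laplace_uminus harm bdry x)
    then show "f x \<le> 0"
      by simp
  qed
  have "v $ i = 0" if "i < 2 * n + 1" for i
    using f0[of "int i - int n"] that by (simp add: f_def)
  then have "v = 0\<^sub>v (2 * n + 1)"
    using v(1) by (intro eq_vecI) auto
  with v(2) show False ..
qed

section \<open>Defining equation, sign and monotonicity of the box Green functions\<close>

lemma box_green_eq_0:
  "x \<notin> {- int n..int n} \<or> y \<notin> {- int n..int n} \<Longrightarrow> box_green D n x y = 0"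
  by (auto simp: box_green_def)

lemma trap_laplace_box_green:
  assumes x: "x \<in> {- int n..int n}" and y: "y \<in> {- int n..int n}"
  shows "trap_laplace D (\<lambda>x. box_green D n x y) x = (if x = y then 1 else 0)"
proof -
  let ?N = "2 * n + 1"
  let ?i = "nat (x + int n)" and ?k = "nat (y + int n)"
  have i: "?i < ?N" "?k < ?N"
    using x y by auto
  \<comment> \<open>Invertibility rules out \<open>None\<close>, so \<open>the\<close> in
    \<open>box_green\<close> is applied to a genuine inverse.\<close>
  have "mat_inverse (box_laplacian D n) \<noteq> None"
    using mat_inverse(1)[OF box_laplacian_carrier[of D n]]
      det_non_zero_imp_unit[OF box_laplacian_carrier det_box_laplacian[of D n]] by metis
  then obtain B where B: "mat_inverse (box_laplacian D n) = Some B"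
    by blast
  have inv: "box_laplacian D n * B = 1\<^sub>m ?N" and carr: "B \<in> carrier_mat ?N ?N"
    using mat_inverse(2)[OF box_laplacian_carrier B] by auto
  have "trap_laplace D (\<lambda>x. box_green D n x y) x
      = (\<Sum>j<?N. box_laplacian D n $$ (?i, j) * B $$ (j, ?k))"
    unfolding box_laplacian_row_sum[OF x, of D "\<lambda>j. B $$ (j, ?k)"]
    using y by (intro arg_cong[where f = "\<lambda>f. trap_laplace D f x"]) (auto simp: box_green_def B)
  also have "\<dots> = (box_laplacian D n * B) $$ (?i, ?k)"
    using i carr box_laplacian_carrier[of D n]
    by (simp add: scalar_prod_def atLeast0LessThan)
  also have "\<dots> = (if x = y then 1 else 0)"
    using i x y by (auto simp: inv)
  finally show ?thesis .
qed

lemma box_green_nonneg: "0 \<le> box_green D n x y"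
proof (cases "x \<in> {- int n..int n} \<and> y \<in> {- int n..int n}")
  case True
  show ?thesis
    by (rule trap_laplace_minimum_principle[of "- int n" "int n" D "\<lambda>x. box_green D n x y"])
      (use True in \<open>auto simp: trap_laplace_box_green box_green_eq_0\<close>)
qed (auto simp: box_green_eq_0)

text \<open>In the smaller box both functions have the same Laplacian, so their difference is
  harmonic there. Just outside, the smaller one is 0 and the larger one nonnegative, so the minimum
  principle applies.\<close>

lemma incseq_box_green: "incseq (\<lambda>n. box_green D n x y)"
proof (rule incseq_SucI)
  fix n
  show "box_green D n x y \<le> box_green D (Suc n) x y"
  proof (cases "x \<in> {- int n..int n} \<and> y \<in> {- int n..int n}")
    case True
    have "0 \<le> box_green D (Suc n) x y - box_green D n x y"
      by (rule trap_laplace_minimum_principle[of "- int n" "int n" D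
            "\<lambda>x. box_green D (Suc n) x y - box_green D n x y"])
        (use True in \<open>auto simp: trap_laplace_diff trap_laplace_box_green box_green_eq_0 box_green_nonneg\<close>)
    then show ?thesis
      by simp
  qed (auto simp: box_green_eq_0 box_green_nonneg)
qed

lemma green_eq_SUP: "green D x y = (SUP n. ennreal (box_green D n x y))"
  unfolding green_def
  by (intro limI LIMSEQ_SUP monoI ennreal_leI incseqD[OF incseq_box_green])

section \<open>Row sums of the box Green functions and their limit\<close>

definition box_green_sum :: "int set \<Rightarrow> nat \<Rightarrow> int \<Rightarrow> real" where
  "box_green_sum D n x = (\<Sum>y\<in>{- int n..int n}. box_green D n x y)"

lemma box_green_sum_nonneg: "0 \<le> box_green_sum D n x"
  by (simp add: box_green_sum_def sum_nonneg box_green_nonneg)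

lemma box_green_sum_eq_0: "x \<notin> {- int n..int n} \<Longrightarrow> box_green_sum D n x = 0"
  by (simp add: box_green_sum_def box_green_eq_0)

lemma sum_box_green_le:
  assumes "finite F"
  shows "(\<Sum>y\<in>F. box_green D n x y) \<le> box_green_sum D n x"
proof -
  have "(\<Sum>y\<in>F. box_green D n x y) = (\<Sum>y\<in>F \<inter> {- int n..int n}. box_green D n x y)"
    using assms by (intro sum.mono_neutral_right) (auto simp: box_green_eq_0)
  also have "\<dots> \<le> box_green_sum D n x"
    unfolding box_green_sum_def by (intro sum_mono2) (auto simp: box_green_nonneg)
  finally show ?thesis .
qed

lemma trap_laplace_box_green_sum:
  "x \<in> {- int n..int n} \<Longrightarrow> trap_laplace D (box_green_sum D n) x = 1"
  unfolding box_green_sum_def[abs_def] by (simp add: trap_laplace_sum trap_laplace_box_green)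

text \<open>Monotone convergence. Finite sums commute with increasing suprema, which bounds each
  finite partial sum; conversely each box sum is dominated by a finite partial sum of
  \<open>green\<close>.\<close>

lemma infsum_green_eq: "(\<Sum>\<^sub>\<infinity>y. green D x y) = (SUP n. ennreal (box_green_sum D n x))"
proof (rule antisym)
  have "(\<Sum>y\<in>F. green D x y) \<le> (SUP n. ennreal (box_green_sum D n x))" if "finite F" for F
  proof -
    have "(\<Sum>y\<in>F. green D x y) = (SUP n. \<Sum>y\<in>F. ennreal (box_green D n x y))"
      unfolding green_eq_SUP
      by (intro ennreal_SUP_sum[symmetric] monoI ennreal_leI incseqD[OF incseq_box_green])
    also have "\<dots> \<le> (SUP n. ennreal (box_green_sum D n x))"
      by (intro SUP_mono' ) (simp add: sum_ennreal box_green_nonneg ennreal_leI sum_box_green_le[OF that])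
    finally show ?thesis .
  qed
  then show "(\<Sum>\<^sub>\<infinity>y. green D x y) \<le> (SUP n. ennreal (box_green_sum D n x))"
    by (intro infsum_le_finite_sums nonneg_summable_on_complete) auto
  have "ennreal (box_green_sum D n x) \<le> (\<Sum>\<^sub>\<infinity>y. green D x y)" for n
  proof -
    have "ennreal (box_green_sum D n x) = (\<Sum>y\<in>{- int n..int n}. ennreal (box_green D n x y))"
      by (simp add: box_green_sum_def sum_ennreal box_green_nonneg)
    also have "\<dots> \<le> (\<Sum>y\<in>{- int n..int n}. green D x y)"
      unfolding green_eq_SUP by (intro sum_mono SUP_upper) simp
    also have "\<dots> = (\<Sum>\<^sub>\<infinity>y\<in>{- int n..int n}. green D x y)"
      by simp
    also have "\<dots> \<le> (\<Sum>\<^sub>\<infinity>y. green D x y)"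
      by (intro infsum_mono_neutral nonneg_summable_on_complete) auto
    finally show ?thesis .
  qed
  then show "(SUP n. ennreal (box_green_sum D n x)) \<le> (\<Sum>\<^sub>\<infinity>y. green D x y)"
    by (intro SUP_least)
qed

section \<open>Survival probabilities of the walk\<close>

text \<open>The law of the first \<open>n + 1\<close> states, built by recursion on the first step.
  It allows first-step induction, whereas the path measure is built by adding steps at the
  end.\<close>

primrec walk_path :: "int set \<Rightarrow> nat \<Rightarrow> int option \<Rightarrow> int option list pmf" where
  "walk_path D 0 z = return_pmf [z]"
| "walk_path D (Suc n) z = map_pmf ((#) z) (walk_step D z \<bind> walk_path D n)"

lemma set_walk_path: "l \<in> set_pmf (walk_path D n z) \<Longrightarrow> length l = Suc n \<and> hd l = z"
  by (induction n arbitrary: z l) (auto simp: set_bind_pmf)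

text \<open>The right-hand side is the cylinder probability of
  \<open>emeasure_walk_cylinder\<close>; this is what later identifies the two laws.\<close>

lemma pmf_walk_path:
  "pmf (walk_path D n z) (map w [0..<Suc n]) =
    indicator {z} (w 0) * (\<Prod>i<n. pmf (walk_step D (w i)) (w (Suc i)))"
proof (induction n arbitrary: z w)
  case 0
  then show ?case by (auto simp: indicator_def)
next
  case (Suc n)
  let ?l = "map (\<lambda>i. w (Suc i)) [0..<Suc n]"
  let ?c = "\<Prod>i<n. pmf (walk_step D (w (Suc i))) (w (Suc (Suc i)))"
  have l: "map w [0..<Suc (Suc n)] = w 0 # ?l"
    by (simp add: upt_conv_Cons map_Suc_upt[symmetric] del: upt_Suc)
  show ?case
  proof (cases "w 0 = z")
    case False
    then have "pmf (walk_path D (Suc n) z) (w 0 # ?l) = 0"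
      by (auto simp: pmf_eq_0_set_pmf)
    with False show ?thesis
      unfolding l by simp
  next
    case True
    have "pmf (walk_path D (Suc n) z) (w 0 # ?l) = pmf (walk_step D z \<bind> walk_path D n) ?l"
      unfolding walk_path.simps True by (rule pmf_map_inj') simp
    also have "\<dots> = (LINT y|walk_step D z. indicator {y} (w (Suc 0)) * ?c)"
      unfolding pmf_bind Suc.IH ..
    \<comment> \<open>Only a first step into \<open>w (Suc 0)\<close> contributes, and the remaining
      product does not depend on \<open>y\<close>.\<close>
    also have "\<dots> = (LINT y|walk_step D z. indicator {w (Suc 0)} y) * ?c"
      by (simp add: indicator_def eq_commute)
    also have "\<dots> = pmf (walk_step D z) (w (Suc 0)) * ?c"
      by (simp add: pmf.rep_eq)
    finally show ?thesis
      unfolding l by (simp add: True prod.lessThan_Suc_shift del: walk_path.simps prod.lessThan_Suc upt_Suc)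
  qed
qed

section \<open>Law of finite prefixes under the path measure\<close>

lemma measurable_walk_coordinate [measurable]:
  "(\<lambda>\<omega>. \<omega> n) \<in> measurable (walk D x) (count_space UNIV)"
  unfolding measurable_cong_sets[OF sets_walk refl]
  by (rule measurable_component_singleton) simp

lemma sets_walk_cylinder: "{\<omega>. \<forall>i\<in>{0..<n}. \<omega> i = w i} \<in> sets (walk D x)"
proof -
  have "{\<omega> \<in> space (walk D x). \<forall>i\<in>{0..<n}. \<omega> i = w i} \<in> sets (walk D x)"
    by measurable
  then show ?thesis by simp
qed

text \<open>Lists over a countable type are countable, so preimages of singletons suffice: these are
  cylinders, or empty when the length is wrong.\<close>

lemma measurable_walk_prefix:
  "(\<lambda>\<omega>. map \<omega> [0..<n]) \<in> measurable (walk D x) (count_space UNIV)"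
proof -
  have "(\<lambda>\<omega>. map \<omega> [0..<n]) -` {l} \<in> sets (walk D x)" for l
  proof (cases "length l = n")
    case True
    then have "(map \<omega> [0..<n] = l) = (\<forall>i\<in>{0..<n}. \<omega> i = l ! i)" for \<omega>
      by (simp add: list_eq_iff_nth_eq Ball_def)
    then show ?thesis
      by (simp only: vimage_def singleton_iff sets_walk_cylinder)
  next
    case False
    then have "(\<lambda>\<omega>. map \<omega> [0..<n]) -` {l} = {}"
      by auto
    then show ?thesis by (simp only: sets.empty_sets)
  qed
  then show ?thesis
    by (simp only: measurable_count_space_eq2_countable space_walk Int_UNIV_right) simp
qed

text \<open>Two measures on a countable space agree once they agree on singletons; lists of the
  wrong length are null for both.\<close>

lemma distr_walk_prefix:
  "distr (walk D x) (count_space UNIV) (\<lambda>\<omega>. map \<omega> [0..<Suc n]) = measure_pmf (walk_path D n (Some x))"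
proof (rule measure_eqI_countable[where A = UNIV])
  fix l :: "int option list"
  have "emeasure (distr (walk D x) (count_space UNIV) (\<lambda>\<omega>. map \<omega> [0..<Suc n])) {l}
      = emeasure (walk D x) {\<omega>. map \<omega> [0..<Suc n] = l}"
    by (subst emeasure_distr[OF measurable_walk_prefix])
      (auto intro!: arg_cong[where f = "emeasure (walk D x)"])
  also have "\<dots> = emeasure (measure_pmf (walk_path D n (Some x))) {l}"
  proof (cases "length l = Suc n")
    case True
    then have l: "l = map (\<lambda>i. l ! i) [0..<Suc n]"
      by (metis map_nth)
    have "{\<omega>. map \<omega> [0..<Suc n] = l} = {\<omega>. \<forall>i\<le>n. \<omega> i = l ! i}"
      using True by (auto simp: list_eq_iff_nth_eq less_Suc_eq_le nth_append simp del: upt_Suc)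
    then have "emeasure (walk D x) {\<omega>. map \<omega> [0..<Suc n] = l}
        = ennreal (pmf (walk_path D n (Some x)) (map (\<lambda>i. l ! i) [0..<Suc n]))"
      unfolding pmf_walk_path by (simp only: emeasure_walk_cylinder)
    then show ?thesis
      unfolding l[symmetric] by (simp add: emeasure_pmf_single)
  next
    case False
    then have "{\<omega>. map \<omega> [0..<Suc n] = l} = {}"
      by auto
    moreover have "pmf (walk_path D n (Some x)) l = 0"
      using False set_walk_path by (auto simp: pmf_eq_0_set_pmf)
    ultimately show ?thesis
      by (simp add: emeasure_pmf_single)
  qed
  finally show "emeasure (distr (walk D x) (count_space UNIV) (\<lambda>\<omega>. map \<omega> [0..<Suc n])) {l}
      = emeasure (measure_pmf (walk_path D n (Some x))) {l}" .
qed (simp_all only: sets_distr sets_count_space sets_measure_pmf Pow_UNIV countableI_type)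

text \<open>The probability that the walk from \<open>x\<close> has avoided the sink up to time
  \<open>n\<close>, see \<open>emeasure_walk_alive\<close>. The degree counts all possible moves;
  the move to the sink contributes 0 to the numerator.\<close>

fun survival :: "int set \<Rightarrow> nat \<Rightarrow> int \<Rightarrow> real" where
  "survival D 0 x = 1"
| "survival D (Suc n) x = (survival D n (x - 1) + survival D n (x + 1)) / trap_deg D x"

lemma trap_deg_pos: "0 < trap_deg D x"
  using trap_deg_ge[of D x] by simp

lemma survival_nonneg: "0 \<le> survival D n x"
  by (induction n arbitrary: x) (simp_all add: order_less_imp_le[OF trap_deg_pos])

lemma emeasure_walk_path_None: "emeasure (walk_path D n None) {l. None \<notin> set l} = 0"
proof -
  have "None \<in> set l" if "l \<in> set_pmf (walk_path D n None)" for l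
    using set_walk_path[OF that] by (cases l) simp_all
  then show ?thesis
    by (auto simp: measure_pmf.emeasure_eq_measure measure_pmf_zero_iff)
qed

lemma emeasure_walk_path_Some:
  "emeasure (walk_path D n (Some x)) {l. None \<notin> set l} = ennreal (survival D n x)"
proof (induction n arbitrary: x)
  case 0
  then show ?case by simp
next
  case (Suc n)
  let ?a = "survival D n (x - 1)" and ?b = "survival D n (x + 1)"
  have nn: "0 \<le> ?a" "0 \<le> ?b"
    by (rule survival_nonneg)+
  have "(#) (Some x) -` {l. None \<notin> set l} = {l. (None :: int option) \<notin> set l}"
    by auto
  then have "emeasure (walk_path D (Suc n) (Some x)) {l. None \<notin> set l}
      = (\<integral>\<^sup>+ y. emeasure (walk_path D n y) {l. None \<notin> set l} \<partial>walk_step D (Some x))"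
    by simp
  \<comment> \<open>The step is uniform on \<open>trap_deg D x\<close> outcomes, of which only the
    two neighbours have nonzero survival probability.\<close>
  also have "\<dots> = ennreal (?a + ?b) / ennreal (trap_deg D x)"
  proof (cases "x \<in> D")
    case True
    then show ?thesis using nn
      by (simp add: walk_step_def nn_integral_pmf_of_set emeasure_walk_path_None Suc.IH
          trap_deg_def ennreal_plus)
  next
    case False
    then show ?thesis using nn
      by (simp add: walk_step_def nn_integral_pmf_of_set Suc.IH trap_deg_def ennreal_plus)
  qed
  also have "\<dots> = ennreal (survival D (Suc n) x)"
    using nn trap_deg_pos[of D x] by (simp add: divide_ennreal del: ennreal_plus)
  finally show ?case .
qed

lemma emeasure_walk_alive:
  "emeasure (walk D x) {\<omega>. \<forall>k\<le>n. \<omega> k \<noteq> None} = ennreal (survival D n x)"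
proof -
  have "{\<omega>. \<forall>k\<le>n. \<omega> k \<noteq> None}
      = (\<lambda>\<omega>. map \<omega> [0..<Suc n]) -` {l. (None :: int option) \<notin> set l} \<inter> space (walk D x)"
    unfolding vimage_def mem_Collect_eq set_map set_upt atLeast0LessThan lessThan_Suc_atMost
      image_iff space_walk Int_UNIV_right
    by (intro Collect_cong) (metis atMost_iff)
  then have "emeasure (walk D x) {\<omega>. \<forall>k\<le>n. \<omega> k \<noteq> None}
      = emeasure (distr (walk D x) (count_space UNIV) (\<lambda>\<omega>. map \<omega> [0..<Suc n])) {l. None \<notin> set l}"
    by (simp only: emeasure_distr[OF measurable_walk_prefix] sets_count_space Pow_UNIV UNIV_I)
  then show ?thesis
    by (simp only: distr_walk_prefix emeasure_walk_path_Some)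
qed

text \<open>Pathwise tail-sum formula: T is the number of times \<open>n\<close> with T >
  \<open>n\<close>. A path starting in the sink must be excluded, since T only looks at times from 1
  on while the series would be 0.\<close>

lemma sink_time_eq_suminf:
  assumes "\<omega> 0 \<noteq> None"
  shows "sink_time \<omega> = (\<Sum>n. indicator {\<omega>. \<forall>k\<le>n. \<omega> k \<noteq> None} \<omega>)"
proof (cases "\<exists>n. \<omega> n = None")
  case True
  define m where "m = (LEAST n. \<omega> n = None)"
  have m: "\<omega> m = None" and least: "\<And>k. k < m \<Longrightarrow> \<omega> k \<noteq> None"
    unfolding m_def using True by (auto intro: LeastI_ex dest: not_less_Least)
  have "m \<noteq> 0"
    using assms m by metis
  have "sink_time \<omega> = of_nat m"
    unfolding sink_time_def
  proof (rule antisym)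
    show "(INF n\<in>{n. 1 \<le> n \<and> \<omega> n = None}. of_nat n) \<le> (of_nat m :: ennreal)"
      using m \<open>m \<noteq> 0\<close> by (intro INF_lower) auto
    show "of_nat m \<le> (INF n\<in>{n. 1 \<le> n \<and> \<omega> n = None}. of_nat n :: ennreal)"
    proof (rule INF_greatest)
      fix n
      assume "n \<in> {n. 1 \<le> n \<and> \<omega> n = None}"
      with least[of n] have "m \<le> n"
        by (cases "n < m") auto
      then show "of_nat m \<le> (of_nat n :: ennreal)"
        by simp
    qed
  qed
  also have "\<dots> = (\<Sum>n<m. indicator {\<omega>. \<forall>k\<le>n. \<omega> k \<noteq> None} \<omega>)"
    using least by (simp add: indicator_def)
  also have "\<dots> = (\<Sum>n. indicator {\<omega>. \<forall>k\<le>n. \<omega> k \<noteq> None} \<omega>)"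
    using m by (intro suminf_finite[symmetric]) (auto simp: indicator_def not_less)
  finally show ?thesis .
next
  case False
  \<comment> \<open>The infimum over the empty set is the top element.\<close>
  then have "sink_time \<omega> = \<infinity>"
    by (simp add: sink_time_def)
  moreover have "indicator {\<omega>. \<forall>k\<le>n. \<omega> k \<noteq> None} \<omega> = (1 :: ennreal)" for n
    using False by simp
  moreover have "(\<Sum>n::nat. 1 :: ennreal) = \<infinity>"
    by (simp add: suminf_eq_SUP ennreal_SUP_of_nat_eq_top)
  ultimately show ?thesis
    by (simp only:)
qed

text \<open>Supplies the hypothesis of \<open>sink_time_eq_suminf\<close> almost surely; it is the
  case \<open>n = 0\<close> of \<open>emeasure_walk_alive\<close>.\<close>

lemma AE_walk_start: "AE \<omega> in walk D x. \<omega> 0 \<noteq> None"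
proof -
  interpret prob_space "walk D x"
    by (rule prob_space_walk)
  have *: "{\<omega>. \<forall>k\<le>0. \<omega> k \<noteq> None} = {\<omega> \<in> space (walk D x). \<omega> 0 \<noteq> None}"
    by (simp add: le_0_eq)
  have "emeasure (walk D x) {\<omega> \<in> space (walk D x). \<omega> 0 \<noteq> None} = 1"
    unfolding *[symmetric] emeasure_walk_alive by simp
  then have "prob {\<omega> \<in> space (walk D x). \<omega> 0 \<noteq> None} = 1"
    by (simp add: measure_def del: not_None_eq)
  from AE_prob_1[OF this] show ?thesis
    by (simp del: not_None_eq)
qed

lemma expected_sink_time_eq: "expected_sink_time D x = (\<Sum>n. ennreal (survival D n x))"
proof -
  have [measurable]: "{\<omega>. \<forall>k\<le>n. \<omega> k \<noteq> None} \<in> sets (walk D x)" for n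
  proof -
    have "{\<omega> \<in> space (walk D x). \<forall>k\<in>{..n}. \<omega> k \<noteq> None} \<in> sets (walk D x)"
      by measurable
    then show ?thesis by (simp add: Ball_def del: not_None_eq)
  qed
  have "expected_sink_time D x
      = (\<integral>\<^sup>+ \<omega>. (\<Sum>n. indicator {\<omega>. \<forall>k\<le>n. \<omega> k \<noteq> None} \<omega>) \<partial>walk D x)"
    unfolding expected_sink_time_def
    by (intro nn_integral_cong_AE eventually_mono[OF AE_walk_start] sink_time_eq_suminf)
  also have "\<dots> = (\<Sum>n. \<integral>\<^sup>+ \<omega>. indicator {\<omega>. \<forall>k\<le>n. \<omega> k \<noteq> None} \<omega> \<partial>walk D x)"
    by (intro nn_integral_suminf) measurable
  also have "\<dots> = (\<Sum>n. ennreal (survival D n x))"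
    by (simp add: emeasure_walk_alive del: not_None_eq)
  finally show ?thesis .
qed

section \<open>Comparison of expected sink time and Green function\<close>

text \<open>Split off the term \<open>n = 0\<close> of the series and apply the survival recursion
  to the rest. In \<open>ennreal\<close> the identity also covers infinite values.\<close>

lemma expected_sink_time_rec:
  "expected_sink_time D x =
    1 + ennreal (1 / trap_deg D x) * (expected_sink_time D (x - 1) + expected_sink_time D (x + 1))"
proof -
  have "(\<lambda>n. ennreal (survival D (Suc n) x)) sums (\<Sum>n. ennreal (survival D (Suc n) x))"
    by (intro summable_sums summableI)
  then have "(\<lambda>n. ennreal (survival D n x)) sums ((\<Sum>n. ennreal (survival D (Suc n) x)) + 1)"
    using sums_Suc[of "\<lambda>n. ennreal (survival D n x)"] by simp
  then have "expected_sink_time D x = 1 + (\<Sum>n. ennreal (survival D (Suc n) x))"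
    unfolding expected_sink_time_eq by (subst sums_unique[symmetric], assumption) (rule add.commute)
  also have "(\<Sum>n. ennreal (survival D (Suc n) x)) = (\<Sum>n. ennreal (1 / trap_deg D x) *
      (ennreal (survival D n (x - 1)) + ennreal (survival D n (x + 1))))"
    using trap_deg_pos[of D x]
    by (simp add: survival_nonneg ennreal_mult[symmetric] ennreal_plus[symmetric] del: ennreal_plus)
  also have "\<dots> = ennreal (1 / trap_deg D x) *
      (expected_sink_time D (x - 1) + expected_sink_time D (x + 1))"
    by (simp add: expected_sink_time_eq suminf_add[symmetric] summableI)
  finally show ?thesis .
qed

text \<open>The coefficient \<open>1 / trap_deg D x\<close> is strictly positive, so an infinite
  value at a neighbour would make the value at \<open>x\<close> infinite.\<close>

lemma expected_sink_time_finite_neighbours: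
  assumes "expected_sink_time D x < \<infinity>"
  shows "expected_sink_time D (x - 1) < \<infinity>" "expected_sink_time D (x + 1) < \<infinity>"
  using assms trap_deg_pos[of D x] unfolding expected_sink_time_rec[of D x]
  by (auto simp: ennreal_add_less_top ennreal_mult_less_top)

lemma expected_sink_time_finite_everywhere:
  assumes "expected_sink_time D x < \<infinity>"
  shows "expected_sink_time D y < \<infinity>"
  by (induction y rule: int_induct[where k = x])
    (use assms expected_sink_time_finite_neighbours in auto)

lemma noncritical_if_expected_sink_time_finite:
  assumes fin: "\<And>x. expected_sink_time D x < \<infinity>"
  shows "noncritical D"
  unfolding noncritical_def
proof
  fix x
  define e where "e = (\<lambda>x. enn2real (expected_sink_time D x))"
  have E: "expected_sink_time D x = ennreal (e x)" and e_nonneg: "0 \<le> e x" for x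
    using fin[of x] by (simp_all add: e_def)
  have lap: "trap_laplace D e x = trap_deg D x" for x
  proof -
    have "ennreal (e x) = ennreal 1 + ennreal (1 / trap_deg D x) * ennreal (e (x - 1) + e (x + 1))"
      using expected_sink_time_rec[of D x] by (simp add: E e_nonneg)
    also have "ennreal (1 / trap_deg D x) * ennreal (e (x - 1) + e (x + 1))
        = ennreal (1 / trap_deg D x * (e (x - 1) + e (x + 1)))"
      using trap_deg_pos[of D x] by (intro ennreal_mult[symmetric]) (simp_all add: e_nonneg)
    also have "ennreal 1 + \<dots> = ennreal (1 + 1 / trap_deg D x * (e (x - 1) + e (x + 1)))"
      using trap_deg_pos[of D x] by (intro ennreal_plus[symmetric]) (simp_all add: e_nonneg)
    finally have "ennreal (e x) = ennreal (1 + 1 / trap_deg D x * (e (x - 1) + e (x + 1)))" .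
    then have "e x = 1 + 1 / trap_deg D x * (e (x - 1) + e (x + 1))"
      using trap_deg_pos[of D x] by (subst (asm) ennreal_inj) (simp_all add: e_nonneg)
    then show ?thesis
      using trap_deg_pos[of D x] by (simp add: trap_laplace_def field_simps)
  qed
  have le: "box_green_sum D n x \<le> e x" for n
  proof (cases "x \<in> {- int n..int n}")
    case True
    \<comment> \<open>Inside the box the difference has Laplacian \<open>trap_deg D z - 1\<close>,
      at least 1; outside it equals \<open>e\<close>, which is nonnegative.\<close>
    have "0 \<le> e x - box_green_sum D n x"
    proof (rule trap_laplace_minimum_principle[of "- int n" "int n" D "\<lambda>x. e x - box_green_sum D n x"])
      fix z
      assume "- int n \<le> z" "z \<le> int n"
      then show "0 \<le> trap_laplace D (\<lambda>x. e x - box_green_sum D n x) z"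
        using trap_deg_ge[of D z] by (simp add: trap_laplace_diff lap trap_laplace_box_green_sum)
    qed (use True e_nonneg in \<open>auto simp: box_green_sum_eq_0\<close>)
    then show ?thesis
      by simp
  qed (simp add: box_green_sum_eq_0 e_nonneg)
  have "(\<Sum>\<^sub>\<infinity>y. green D x y) \<le> ennreal (e x)"
    unfolding infsum_green_eq by (intro SUP_least ennreal_leI le)
  then show "(\<Sum>\<^sub>\<infinity>y. green D x y) < \<infinity>"
    by (rule order_le_less_trans) simp
qed

section \<open>Bounding the expected sink time by Green function sums\<close>

lemma sum_survival_Suc:
  "(\<Sum>k<Suc m. survival D k x) =
    1 + ((\<Sum>k<m. survival D k (x - 1)) + (\<Sum>k<m. survival D k (x + 1))) / trap_deg D x"
  by (simp add: sum.lessThan_Suc_shift sum.distrib sum_divide_distrib add_divide_distrib del: sum.lessThan_Suc)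

text \<open>Induction on \<open>m\<close>: each recursion step moves to a neighbour and lowers
  \<open>m\<close> by one, so the hypothesis keeps every site where the recursion is used inside the
  box, where \<open>box_green_sum\<close> has Laplacian 1.\<close>

lemma sum_survival_le_box_green_sum:
  "\<bar>x\<bar> + int m \<le> int n \<Longrightarrow> (\<Sum>k<m. survival D k x) \<le> 3 * box_green_sum D n x"
proof (induction m arbitrary: x)
  case 0
  then show ?case
    by (simp add: box_green_sum_nonneg)
next
  case (Suc m)
  let ?d = "trap_deg D x" and ?s = "box_green_sum D n"
  have box: "x \<in> {- int n..int n}"
    using Suc.prems by auto
  from trap_laplace_box_green_sum[OF box, of D]
  have sum: "3 * ?s (x - 1) + 3 * ?s (x + 1) = 3 * (?d * ?s x - 1)"
    by (simp add: trap_laplace_def)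
  have "(\<Sum>k<m. survival D k (x - 1)) + (\<Sum>k<m. survival D k (x + 1)) \<le> 3 * ?s (x - 1) + 3 * ?s (x + 1)"
    using Suc.prems by (intro add_mono Suc.IH) auto
  also have "\<dots> = 3 * (?d * ?s x - 1)"
    by (rule sum)
  \<comment> \<open>This is where the factor 3 comes from: the inequality reduces to
    \<open>trap_deg D x \<le> 3\<close>.\<close>
  also have "\<dots> \<le> ?d * (3 * ?s x - 1)"
    using trap_deg_le[of D x] by (simp add: algebra_simps)
  finally have "((\<Sum>k<m. survival D k (x - 1)) + (\<Sum>k<m. survival D k (x + 1))) / ?d \<le> 3 * ?s x - 1"
    using trap_deg_pos[of D x] by (simp add: pos_divide_le_eq mult.commute)
  then show ?case
    unfolding sum_survival_Suc by simp
qed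

lemma expected_sink_time_le: "expected_sink_time D x \<le> 3 * (\<Sum>\<^sub>\<infinity>y. green D x y)"
  unfolding expected_sink_time_eq suminf_eq_SUP
proof (rule SUP_least)
  fix m
  \<comment> \<open>The smallest box that the previous bound allows for \<open>m\<close> terms at
    \<open>x\<close>; it grows with \<open>m\<close>, and the supremum over all boxes absorbs
    it.\<close>
  let ?n = "nat \<bar>x\<bar> + m"
  have "(\<Sum>k<m. ennreal (survival D k x)) = ennreal (\<Sum>k<m. survival D k x)"
    by (simp add: sum_ennreal survival_nonneg)
  also have "\<dots> \<le> ennreal (3 * box_green_sum D ?n x)"
    by (intro ennreal_leI sum_survival_le_box_green_sum) simp
  also have "\<dots> = 3 * ennreal (box_green_sum D ?n x)"
    by (simp add: ennreal_mult box_green_sum_nonneg)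
  also have "\<dots> \<le> 3 * (\<Sum>\<^sub>\<infinity>y. green D x y)"
    unfolding infsum_green_eq by (intro mult_left_mono SUP_upper) auto
  finally show "(\<Sum>k<m. ennreal (survival D k x)) \<le> 3 * (\<Sum>\<^sub>\<infinity>y. green D x y)" .
qed

theorem theorem2p1:
  fixes D :: "int set"
  shows "(critical D \<longleftrightarrow> (\<forall>x. expected_sink_time D x = \<infinity>)) \<and>
    ((\<forall>x. expected_sink_time D x = \<infinity>) \<longleftrightarrow> (\<exists>x. expected_sink_time D x = \<infinity>))"
proof -
  \<comment> \<open>This dichotomy makes "infinite somewhere" and "infinite everywhere" the same,
    and turns the failure of finiteness everywhere into infinity everywhere.\<close>
  have all_or_none: "(\<forall>x. expected_sink_time D x = \<infinity>) \<or> (\<forall>x. expected_sink_time D x < \<infinity>)"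
    using expected_sink_time_finite_everywhere[of D] by (auto simp: less_top[symmetric])
  moreover have "noncritical D \<longleftrightarrow> (\<forall>x. expected_sink_time D x < \<infinity>)"
  proof
    assume "noncritical D"
    then have "3 * (\<Sum>\<^sub>\<infinity>y. green D x y) < \<infinity>" for x
      by (auto simp: noncritical_def ennreal_mult_less_top)
    then show "\<forall>x. expected_sink_time D x < \<infinity>"
      using expected_sink_time_le order_le_less_trans by blast
  qed (auto intro: noncritical_if_expected_sink_time_finite)
  ultimately show ?thesis
    unfolding critical_def by (metis order_less_irrefl)
qed

end
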